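(* Let $\mathbb{X}$ and $\mathbb{Y}$ be two paired vector spaces, let $|||\cdot|||$ be a norm on $\mathbb{X}$, and let $c$ be the Caprac coupling between $\mathbb{X}$ and $\mathbb{Y}$ associated with $|||\cdot|||$. Then, for every function $f:\mathbb{X}\to\overline{\mathbb{R}}$, the $c$-Fenchel-Moreau conjugate $f^{c}$ is a convex lower semicontinuous function on $\mathbb{Y}$. In addition, a function on $\mathbb{X}$ with values in $\overline{\mathbb{R}}$ is $c$-convex if and only if it is the composition $F\circ n$ of a convex lower semicontinuous function $F$ on $\mathbb{X}$ with the normalization mapping $n$.
   Context: $\overline{\mathbb{R}}=[-\infty,+\infty]$. Paired vector spaces: $\mathbb{X}$ and $\mathbb{Y}$ are vector spaces equipped with a bilinear form $\langle\cdot,\cdot\rangle$ and locally convex topologies that are compatible in the sense that the continuous linear forms on $\mathbb{X}$ are the functions $x\mapsto\langle x,y\rangle$, for all $y\in\mathbb{Y}$, and the continuous linear forms on $\mathbb{Y}$ are the functions $y\mapsto\langle x,y\rangle$, for all $x\in\mathbb{X}$. The norm $|||\cdot|||$ need not be related to the bilinear form. Normalization mapping: $n:\mathbb{X}\to\{x\in\mathbb{X} : |||x|||=1\}\cup\{0\}$, $n(x)=x/|||x|||$ if $x\neq0$, and $n(0)=0$. Caprac coupling: $c(x,y)=\langle n(x),y\rangle$, that is, $c(x,y)=\langle x,y\rangle/|||x|||$ for $x\neq0$ and $c(0,y)=0$, for all $y\in\mathbb{Y}$. Conjugates: for $f:\mathbb{X}\to\overline{\mathbb{R}}$, $f^{c}(y)=\sup_{x\in\mathbb{X}}\big(c(x,y)+(-f(x))\big)$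 for $y\in\mathbb{Y}$; for $g:\mathbb{Y}\to\overline{\mathbb{R}}$, $g^{c'}(x)=\sup_{y\in\mathbb{Y}}\big(c(x,y)+(-g(y))\big)$ for $x\in\mathbb{X}$; the biconjugate is $f^{cc'}=(f^{c})^{c'}$. (The addition is the Moreau lower addition, which extends the usual one by $(+\infty)+(-\infty)=-\infty$; since $c$ is finite-valued, no such indeterminate sum occurs here.) A function $f:\mathbb{X}\to\overline{\mathbb{R}}$ is $c$-convex if it is of the form $g^{c'}$ for some $g:\mathbb{Y}\to\overline{\mathbb{R}}$, or, equivalently, if $f^{cc'}=f$.
   Formalization: In the equivalence, the convex lsc function F is also required to be identically −∞ if it takes the value −∞; without this the "if" part fails (X=Y=ℝ, F=−∞ on [1/2,+∞), +∞ elsewhere). *)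

theory Defs
  imports "HOL-Analysis.Analysis"
begin

text \<open>Topologies are explicit values of type \<^typ>\<open>'a topology\<close>, so that a vector space may carry any
  compatible topology, unrelated to the norm.  No separation axiom is imposed.\<close>

definition locally_convex_topology :: "'a::real_vector topology \<Rightarrow> bool" where
  "locally_convex_topology T \<longleftrightarrow>
     topspace T = UNIV \<and>
     continuous_map (prod_topology T T) T (\<lambda>(x, y). x + y) \<and>
     continuous_map (prod_topology euclideanreal T) T (\<lambda>(a, x). a *\<^sub>R x) \<and>
     neighbourhood_base_of convex T"

definition continuous_linear_forms :: "'a::real_vector topology \<Rightarrow> ('a \<Rightarrow> real) set" where
  "continuous_linear_forms T = {l. linear l \<and> continuous_map T euclideanreal l}"

definition paired_spaces ::
  "'x::real_vector topology \<Rightarrow> 'y::real_vector topology \<Rightarrow> ('x \<Rightarrow> 'y \<Rightarrow> real) \<Rightarrow> bool" where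
  "paired_spaces TX TY b \<longleftrightarrow>
     bilinear b \<and>
     locally_convex_topology TX \<and> locally_convex_topology TY \<and>
     continuous_linear_forms TX = range (\<lambda>y x. b x y) \<and>
     continuous_linear_forms TY = range (\<lambda>x y. b x y)"

definition norm_on_space :: "('x::real_vector \<Rightarrow> real) \<Rightarrow> bool" where
  "norm_on_space N \<longleftrightarrow>
     (\<forall>x. 0 \<le> N x) \<and> (\<forall>x. N x = 0 \<longleftrightarrow> x = 0) \<and>
     (\<forall>a x. N (a *\<^sub>R x) = \<bar>a\<bar> * N x) \<and> (\<forall>x y. N (x + y) \<le> N x + N y)"

definition normalization :: "('x::real_vector \<Rightarrow> real) \<Rightarrow> 'x \<Rightarrow> 'x" where
  "normalization N x = (if x = 0 then 0 else (1 / N x) *\<^sub>R x)"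

definition caprac ::
  "('x::real_vector \<Rightarrow> 'y::real_vector \<Rightarrow> real) \<Rightarrow> ('x \<Rightarrow> real) \<Rightarrow> 'x \<Rightarrow> 'y \<Rightarrow> real" where
  "caprac b N x y = b (normalization N x) y"

text \<open>Couplings are real-valued, so the sums below never have the form \<open>\<infinity> + -\<infinity>\<close>: the
  convention of \<^typ>\<open>ereal\<close> for that case (which differs from the Moreau lower addition) is
  never used.\<close>

definition coupling_conjugate :: "('x \<Rightarrow> 'y \<Rightarrow> real) \<Rightarrow> ('x \<Rightarrow> ereal) \<Rightarrow> 'y \<Rightarrow> ereal" where
  "coupling_conjugate c f y = (SUP x. ereal (c x y) + - f x)"

definition reverse_conjugate :: "('x \<Rightarrow> 'y \<Rightarrow> real) \<Rightarrow> ('y \<Rightarrow> ereal) \<Rightarrow> 'x \<Rightarrow> ereal" where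
  "reverse_conjugate c g x = (SUP y. ereal (c x y) + - g y)"

definition coupling_convex :: "('x \<Rightarrow> 'y \<Rightarrow> real) \<Rightarrow> ('x \<Rightarrow> ereal) \<Rightarrow> bool" where
  "coupling_convex c f \<longleftrightarrow> (\<exists>g. f = reverse_conjugate c g)"

lemma coupling_convex_iff_biconjugate:
  "coupling_convex c f \<longleftrightarrow> reverse_conjugate c (coupling_conjugate c f) = f"
proof
  have swap: "ereal r + - a \<le> b \<longleftrightarrow> ereal r + - b \<le> a" for r a b
    by (cases a; cases b) auto
  have conj_le: "coupling_conjugate c h y \<le> k \<longleftrightarrow> (\<forall>x. ereal (c x y) + - k \<le> h x)" for h y k
    by (auto simp: coupling_conjugate_def SUP_le_iff swap)
  have rev_le: "reverse_conjugate c g x \<le> k \<longleftrightarrow> (\<forall>y. ereal (c x y) + - k \<le> g y)" for g x k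
    by (auto simp: reverse_conjugate_def SUP_le_iff swap)
  assume "coupling_convex c f"
  then obtain g where f: "f = reverse_conjugate c g"
    by (auto simp: coupling_convex_def)
  have "coupling_conjugate c f y \<le> g y" for y
    unfolding conj_le f by (metis rev_le order_refl swap)
  then have "f x \<le> reverse_conjugate c (coupling_conjugate c f) x" for x
    unfolding f by (subst reverse_conjugate_def) (auto simp: reverse_conjugate_def[of c "coupling_conjugate c _"]
        intro!: SUP_mono' add_left_mono)
  moreover have "reverse_conjugate c (coupling_conjugate c f) x \<le> f x" for x
    unfolding rev_le by (metis conj_le order_refl swap)
  ultimately show "reverse_conjugate c (coupling_conjugate c f) = f"
    by (auto intro: antisym)
qed (metis coupling_convex_def)

text \<open>A \<open>c\<close>-convex function that takes the value \<open>-\<infinity>\<close> is identically \<open>-\<infinity>\<close>.  A convex lower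
  semicontinuous function on the reals can be \<open>-\<infinity>\<close> on \<open>[1/2, \<infinity>)\<close> and \<open>+\<infinity>\<close> elsewhere, and then its
  composition with the normalization mapping is not \<open>c\<close>-convex.  Convex lower semicontinuous
  functions representing \<open>c\<close>-convex ones are therefore taken closed in the sense of convex
  analysis: if such a function takes the value \<open>-\<infinity>\<close>, it is identically \<open>-\<infinity>\<close>.\<close>

lemma coupling_convex_minus_infinity:
  assumes "coupling_convex c f" and "f x = -\<infinity>"
  shows "f x' = -\<infinity>"
proof -
  obtain g where f: "f = reverse_conjugate c g"
    using assms(1) by (auto simp: coupling_convex_def)
  have "ereal (c x y) + - g y \<le> -\<infinity>" for y
    using assms(2) unfolding f reverse_conjugate_def by (metis SUP_upper UNIV_I)
  then have "g y = \<infinity>" for y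
    by (metis ereal_infty_less_eq(2) ereal_plus_eq_MInfty ereal_uminus_eq_reorder PInfty_neq_ereal(1) MInfty_neq_ereal(1))
  then show ?thesis
    by (simp add: f reverse_conjugate_def)
qed

definition convex_function :: "('a::real_vector \<Rightarrow> ereal) \<Rightarrow> bool" where
  "convex_function F \<longleftrightarrow> convex {(x, r :: real). F x \<le> ereal r}"

definition lower_semicontinuous :: "'a topology \<Rightarrow> ('a \<Rightarrow> ereal) \<Rightarrow> bool" where
  "lower_semicontinuous T F \<longleftrightarrow> (\<forall>a. closedin T {x \<in> topspace T. F x \<le> a})"

end

theory Submission
  imports Defs
begin

text \<open>The conjugate \<open>f\<^sup>c\<close> is a supremum of continuous affine functions, hence convex and lower
  semicontinuous, and a \<open>c\<close>-convex function is \<open>F \<circ> n\<close> with \<open>F\<close> such a supremum.  For the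
  converse, a proper convex lower semicontinuous \<open>F\<close> is shown to be the supremum of its continuous
  affine minorants.  Given \<open>r < F x\<^sub>0\<close>, there are a continuous gauge \<open>q\<close> and a constant \<open>k\<close> with
  \<open>F z + k q (z - x\<^sub>0) \<ge> r\<close> for all \<open>z\<close>, because \<open>F > r\<close> near \<open>x\<^sub>0\<close> and \<open>F\<close> is bounded below by
  \<open>A - q (z - x\<^sub>0)\<close>; the Hahn-Banach theorem in sandwich form then separates the concave function
  \<open>r - F\<close> from the sublinear function \<open>k q (\<cdot> - x\<^sub>0)\<close> by a linear form.\<close>

section \<open>Sublinear functions and the sandwich theorem\<close>

definition sublinear :: "('a::real_vector \<Rightarrow> real) \<Rightarrow> bool" where
  "sublinear p \<longleftrightarrow>
     (\<forall>x y. p (x + y) \<le> p x + p y) \<and> (\<forall>t x. 0 \<le> t \<longrightarrow> p (t *\<^sub>R x) = t * p x)"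

lemma sublinear_add: "sublinear p \<Longrightarrow> p (x + y) \<le> p x + p y"
  by (simp add: sublinear_def)

lemma sublinear_scale: "sublinear p \<Longrightarrow> 0 \<le> t \<Longrightarrow> p (t *\<^sub>R x) = t * p x"
  by (simp add: sublinear_def)

lemma sublinear_0: "sublinear p \<Longrightarrow> p 0 = 0"
  using sublinear_scale[of p 0 0] by simp

lemma sublinear_minus: "sublinear p \<Longrightarrow> - p (- x) \<le> p x"
  using sublinear_add[of p x "- x"] by (simp add: sublinear_0)

text \<open>Applying the one-sided scaling bound with \<open>inverse t\<close> as well gives the
  reverse inequality. For functions defined by infima, only the upper bound is then left to
  check.\<close>

lemma sublinearI:
  assumes "\<And>x y. p (x + y) \<le> p x + p y" and "p 0 = 0"
    and le: "\<And>t x. 0 < t \<Longrightarrow> p (t *\<^sub>R x) \<le> t * p x"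
  shows "sublinear p"
proof -
  have "p (t *\<^sub>R x) = t * p x" if "0 \<le> t" for t x
  proof (cases "t = 0")
    case False
    with that have t: "0 < t" by simp
    have "t * p x = t * p (inverse t *\<^sub>R (t *\<^sub>R x))"
      using t by simp
    also have "\<dots> \<le> t * (inverse t * p (t *\<^sub>R x))"
      using t by (intro mult_left_mono le) auto
    finally show ?thesis
      using le[OF t, of x] t by (simp add: field_simps)
  qed (use assms in simp)
  then show ?thesis
    using assms by (simp add: sublinear_def)
qed

text \<open>The new function is the infimum of \<open>p (w + u) - s\<close> over the cone; closure
  of \<open>K\<close> under sums and positive multiples makes it sublinear. With a ray for
  \<open>K\<close> this shows that minimal sublinear functions are additive; with the cone over
  \<open>E\<close> it gives the sandwich theorem.\<close>

lemma sublinear_reduce: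
  fixes p :: "'a::real_vector \<Rightarrow> real"
  assumes p: "sublinear p" and K: "convex_cone K" and le: "\<And>u s. (u, s) \<in> K \<Longrightarrow> s \<le> p u"
  obtains q where "sublinear q" "q \<le> p" "\<And>u s w. (u, s) \<in> K \<Longrightarrow> q w \<le> p (w + u) - s"
proof
  define V where "V w = {p (w + u) - s |u s. (u, s) \<in> K}" for w
  define q where "q w = Inf (V w)" for w
  have K0: "(0, 0) \<in> K"
    using convex_cone_contains_0[OF K] by (simp add: zero_prod_def)
  \<comment> \<open>Subadditivity for \<open>u = (w + u) + (- w)\<close> bounds all candidates below
    by one number, so the real infimum behaves as expected.\<close>
  have lower: "- p (- w) \<le> v" if v: "v \<in> V w" for w v
  proof -
    obtain u s where "v = p (w + u) - s" "(u, s) \<in> K"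
      using v by (auto simp: V_def)
    then show ?thesis
      using le[of u s] sublinear_add[OF p, of "w + u" "- w"] by (simp add: algebra_simps)
  qed
  then have bdd: "bdd_below (V w)" for w
    by (meson bdd_belowI)
  show upper: "q w \<le> p (w + u) - s" if "(u, s) \<in> K" for u s w
    unfolding q_def using that by (intro cInf_lower bdd) (auto simp: V_def)
  have ne: "V w \<noteq> {}" for w
    using K0 by (auto simp: V_def)
  have greatest: "a \<le> q w" if "\<And>u s. (u, s) \<in> K \<Longrightarrow> a \<le> p (w + u) - s" for a w
    unfolding q_def using that by (intro cInf_greatest ne) (auto simp: V_def)
  show "q \<le> p"
    using upper[OF K0] by (auto simp: le_fun_def)
  show "sublinear q"
  proof (rule sublinearI)
    fix x y
    have "q (x + y) - (p (y + u') - s') \<le> p (x + u) - s"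
      if "(u, s) \<in> K" "(u', s') \<in> K" for u s u' s'
      using upper[of "u + u'" "s + s'" "x + y"] convex_cone_add[OF K that]
        sublinear_add[OF p, of "x + u" "y + u'"]
      by (simp add: algebra_simps)
    then have "q (x + y) - (p (y + u') - s') \<le> q x" if "(u', s') \<in> K" for u' s'
      using that by (intro greatest) auto
    then have "q (x + y) - q x \<le> q y"
      by (intro greatest) (fastforce simp: algebra_simps)
    then show "q (x + y) \<le> q x + q y"
      by simp
  next
    have "0 \<le> q 0"
      using le by (intro greatest) auto
    then show "q 0 = 0"
      using upper[OF K0, of 0] sublinear_0[OF p] by simp
  next
    fix t :: real and x
    assume t: "0 < t"
    have "inverse t * q (t *\<^sub>R x) \<le> p (x + u) - s" if "(u, s) \<in> K" for u s
    proof -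
      have "q (t *\<^sub>R x) \<le> p (t *\<^sub>R x + t *\<^sub>R u) - t * s"
        using convex_cone_scaleR[OF K _ that, of t] t by (intro upper) auto
      also have "\<dots> = t * (p (x + u) - s)"
        using sublinear_scale[OF p, of t "x + u"] t by (simp add: algebra_simps)
      finally show ?thesis
        using t by (simp add: field_simps)
    qed
    then have "inverse t * q (t *\<^sub>R x) \<le> q x"
      by (rule greatest)
    then show "q (t *\<^sub>R x) \<le> t * q x"
      using t by (simp add: field_simps)
  qed
qed

text \<open>The pointwise infimum works: all members lie above \<open>- p (- x)\<close>, and
  comparability within the chain preserves subadditivity.\<close>

lemma sublinear_chain_bound:
  fixes C :: "('a::real_vector \<Rightarrow> real) set"
  assumes "C \<noteq> {}" and sub: "\<And>q. q \<in> C \<Longrightarrow> sublinear q" and le: "\<And>q. q \<in> C \<Longrightarrow> q \<le> p"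
    and chain: "\<And>q q'. q \<in> C \<Longrightarrow> q' \<in> C \<Longrightarrow> q \<le> q' \<or> q' \<le> q"
  obtains m where "sublinear m" "\<And>q. q \<in> C \<Longrightarrow> m \<le> q"
proof
  define m where "m x = (INF q\<in>C. q x)" for x
  have "- p (- x) \<le> q x" if "q \<in> C" for q x
    using le[OF that] sublinear_minus[OF sub[OF that], of x]
    by (smt (verit) le_fun_def)
  then have bdd: "bdd_below ((\<lambda>q. q x) ` C)" for x
    by (meson bdd_belowI2)
  have lower: "m x \<le> q x" if "q \<in> C" for q x
    unfolding m_def using that by (intro cINF_lower bdd)
  have greatest: "a \<le> m x" if "\<And>q. q \<in> C \<Longrightarrow> a \<le> q x" for a x
    unfolding m_def using that \<open>C \<noteq> {}\<close> by (intro cINF_greatest)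
  show "m \<le> q" if "q \<in> C" for q
    using lower[OF that] by (simp add: le_fun_def)
  show "sublinear m"
  proof (rule sublinearI)
    fix x y
    \<comment> \<open>The smaller of \<open>q\<close> and \<open>q'\<close> is used for both
      summands.\<close>
    have "m (x + y) - q' y \<le> q x" if "q \<in> C" "q' \<in> C" for q q'
      using chain[OF that] lower[OF that(1), of "x + y"] lower[OF that(2), of "x + y"]
        sublinear_add[OF sub[OF that(1)], of x y] sublinear_add[OF sub[OF that(2)], of x y]
      by (smt (verit) le_fun_def)
    then have "m (x + y) - q' y \<le> m x" if "q' \<in> C" for q'
      using that by (intro greatest) auto
    then have "m (x + y) - m x \<le> m y"
      by (intro greatest) (fastforce simp: algebra_simps)
    then show "m (x + y) \<le> m x + m y"
      by simp
  next
    show "m 0 = 0"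
      using sub \<open>C \<noteq> {}\<close> unfolding m_def by (simp add: sublinear_0)
  next
    fix t :: real and x
    assume t: "0 < t"
    have "inverse t * m (t *\<^sub>R x) \<le> q x" if "q \<in> C" for q
      using lower[OF that, of "t *\<^sub>R x"] sublinear_scale[OF sub[OF that], of t x] t
      by (simp add: field_simps)
    then have "inverse t * m (t *\<^sub>R x) \<le> m x"
      by (rule greatest)
    then show "m (t *\<^sub>R x) \<le> t * m x"
      using t by (simp add: field_simps)
  qed
qed

text \<open>Reducing \<open>q\<close> along the ray through \<open>(u, q u)\<close> gives a
  sublinear function below \<open>q\<close>, hence \<open>q\<close> itself. The point of the ray at
  parameter 1 then yields superadditivity.\<close>

lemma minimal_sublinear_linear:
  assumes q: "sublinear q" and minimal: "\<And>q'. sublinear q' \<Longrightarrow> q' \<le> q \<Longrightarrow> q' = q"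
  shows "linear q"
proof -
  have add: "q (w + u) = q w + q u" for w u
  proof -
    let ?K = "(\<lambda>t. (t *\<^sub>R u, t * q u)) ` {0..}"
    have "convex_cone ?K"
    proof -
      have "linear (\<lambda>t. (t *\<^sub>R u, t * q u))"
        by (intro linearI) (auto simp: algebra_simps)
      moreover have "convex_cone {0::real..}"
        by (auto simp: convex_cone_iff)
      ultimately show ?thesis
        using convex_cone_linear_image by blast
    qed
    then obtain q' where "sublinear q'" "q' \<le> q"
      and q': "\<And>v s w. (v, s) \<in> ?K \<Longrightarrow> q' w \<le> q (w + v) - s"
      using sublinear_scale[OF q] by (elim sublinear_reduce[OF q]) auto
    then have "q' = q"
      using minimal by blast
    moreover have "(u, q u) \<in> ?K"
      by (rule image_eqI[of _ _ 1]) auto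
    ultimately have "q w \<le> q (w + u) - q u"
      using q' by metis
    then show ?thesis
      using sublinear_add[OF q, of w u] by simp
  qed
  have neg: "q (- x) = - q x" for x
    using add[of x "- x"] sublinear_0[OF q] by simp
  show ?thesis
  proof (rule linearI)
    fix x y
    show "q (x + y) = q x + q y"
      by (rule add)
  next
    fix t x
    show "q (t *\<^sub>R x) = t *\<^sub>R q x"
      using sublinear_scale[OF q, of t x] sublinear_scale[OF q, of "- t" x] neg[of "t *\<^sub>R x"]
      by (cases "0 \<le> t") auto
  qed
qed

text \<open>Zorn's lemma is applied to the reversed pointwise order, so that it yields a minimal
  sublinear function below \<open>p\<close>.\<close>

theorem Hahn_Banach_sublinear:
  fixes p :: "'a::real_vector \<Rightarrow> real"
  assumes p: "sublinear p"
  obtains l where "linear l" "l \<le> p"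
proof -
  let ?A = "{q. sublinear q \<and> q \<le> p}"
  have "\<exists>m\<in>?A. \<forall>a\<in>?A. a \<le> m \<longrightarrow> a = m"
  proof (rule predicate_Zorn[where P = "\<lambda>a b. b \<le> a"])
    show "partial_order_on ?A (relation_of (\<lambda>a b. b \<le> a) ?A)"
      by (rule partial_order_on_relation_ofI) auto
  next
    fix C assume C: "C \<in> Chains (relation_of (\<lambda>a b. b \<le> a) ?A)"
    then have sub: "C \<subseteq> ?A" and chain: "\<And>q q'. q \<in> C \<Longrightarrow> q' \<in> C \<Longrightarrow> q \<le> q' \<or> q' \<le> q"
      by (auto simp: Chains_def relation_of_def)
    show "\<exists>u\<in>?A. \<forall>a\<in>C. u \<le> a"
    proof (cases "C = {}")
      case False
      then obtain m where m: "sublinear m" "\<And>q. q \<in> C \<Longrightarrow> m \<le> q"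
        using sub chain by (elim sublinear_chain_bound[of C p]) auto
      moreover have "m \<le> p"
        using False m(2) sub by (blast intro: order_trans)
      ultimately show ?thesis
        by blast
    qed (use p in auto)
  qed
  then obtain m where m: "sublinear m" "m \<le> p"
    and min: "\<And>a. sublinear a \<Longrightarrow> a \<le> p \<Longrightarrow> a \<le> m \<Longrightarrow> a = m"
    by blast
  have "linear m"
    using m min by (intro minimal_sublinear_linear) (auto intro: order_trans)
  with m show ?thesis
    using that by blast
qed

text \<open>\<open>E\<close> plays the part of the hypograph of a concave function below
  \<open>p\<close>. A linear form below the reduction of \<open>p\<close> by the cone over
  \<open>E\<close> lies below \<open>p\<close> and above \<open>E\<close>.\<close>

theorem Hahn_Banach_sandwich:
  fixes p :: "'a::real_vector \<Rightarrow> real"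
  assumes p: "sublinear p" and E: "convex E" and "E \<noteq> {}"
    and le: "\<And>u s. (u, s) \<in> E \<Longrightarrow> s \<le> p u"
  obtains l where "linear l" "l \<le> p" "\<And>u s. (u, s) \<in> E \<Longrightarrow> s \<le> l u"
proof -
  let ?K = "convex_cone hull E"
  \<comment> \<open>Since \<open>E\<close> is convex and nonempty, its convex cone hull consists of
    the nonnegative multiples of its points, and the bound is homogeneous.\<close>
  have dom: "s \<le> p u" if us: "(u, s) \<in> ?K" for u s
  proof -
    obtain c v r where "0 \<le> c" "(v, r) \<in> E" "u = c *\<^sub>R v" "s = c * r"
      using us \<open>E \<noteq> {}\<close>
      by (auto simp: convex_cone_hull_separate_nonempty convex_hull_eq[THEN iffD2, OF E] conic_hull_explicit)
    then show ?thesis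
      using le sublinear_scale[OF p] by (simp add: mult_left_mono)
  qed
  obtain q where q: "sublinear q" "q \<le> p" and qK: "\<And>u s w. (u, s) \<in> ?K \<Longrightarrow> q w \<le> p (w + u) - s"
    using sublinear_reduce[OF p convex_cone_convex_cone_hull dom] by metis
  obtain l where l: "linear l" "l \<le> q"
    using Hahn_Banach_sublinear[OF q(1)] .
  \<comment> \<open>The reduction is evaluated at \<open>w = - u\<close>, where
    \<open>p (w + u)\<close> vanishes.\<close>
  have "s \<le> l u" if "(u, s) \<in> E" for u s
  proof -
    have "- l u = l (- u)"
      using l(1) by (simp add: linear_neg)
    also have "\<dots> \<le> q (- u)"
      using l(2) by (simp add: le_fun_def)
    also have "\<dots> \<le> p (- u + u) - s"
      using that by (intro qK) (simp add: hull_inc)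
    finally show ?thesis
      using sublinear_0[OF p] by simp
  qed
  with l q show ?thesis
    using that order_trans by blast
qed

section \<open>Gauges\<close>

text \<open>The Minkowski functional of \<open>U\<close>. The real infimum is informative only over
  a nonempty set of scales, hence the absorbing assumption in the context below.\<close>

definition gauge_of :: "'a::real_vector set \<Rightarrow> 'a \<Rightarrow> real" where
  "gauge_of U x = Inf {t. 0 < t \<and> x \<in> (*\<^sub>R) t ` U}"

context
  fixes U :: "'a::real_vector set"
  assumes U: "convex U" and absorbing: "\<And>x. \<exists>t>0. x \<in> (*\<^sub>R) t ` U"
begin

lemma gauge_of_nonneg: "0 \<le> gauge_of U x"
  unfolding gauge_of_def using absorbing[of x] by (intro cInf_greatest) auto

lemma gauge_of_le: "0 < t \<Longrightarrow> x \<in> (*\<^sub>R) t ` U \<Longrightarrow> gauge_of U x \<le> t"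
  unfolding gauge_of_def by (intro cInf_lower) (auto intro: bdd_belowI[of _ 0])

lemma gauge_of_le_1: "x \<in> U \<Longrightarrow> gauge_of U x \<le> 1"
  by (rule gauge_of_le) auto

lemma zero_mem_absorbing: "0 \<in> U"
  using absorbing[of 0] by auto

text \<open>Dilates of \<open>U\<close> grow with the scale: \<open>U\<close> is convex and contains
  0, so shrinking \<open>u\<close> towards 0 stays in \<open>U\<close>.\<close>

lemma gauge_of_less:
  assumes "gauge_of U x < t"
  shows "x \<in> (*\<^sub>R) t ` U"
proof -
  have "\<exists>s\<in>{s. 0 < s \<and> x \<in> (*\<^sub>R) s ` U}. s < t"
    using assms absorbing[of x] unfolding gauge_of_def by (intro cInf_lessD) auto
  then obtain s u where s: "0 < s" "s < t" "u \<in> U" "x = s *\<^sub>R u"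
    by auto
  have "(s / t) *\<^sub>R u + (1 - s / t) *\<^sub>R 0 \<in> U"
    using s zero_mem_absorbing by (intro convexD[OF U]) auto
  then have "(s / t) *\<^sub>R u \<in> U"
    by simp
  moreover have "x = t *\<^sub>R ((s / t) *\<^sub>R u)"
    using s by simp
  ultimately show ?thesis
    by blast
qed

lemma sublinear_gauge_of: "sublinear (gauge_of U)"
proof (rule sublinearI)
  fix x y
  show "gauge_of U (x + y) \<le> gauge_of U x + gauge_of U y"
  proof (rule field_le_epsilon)
    fix e :: real
    assume e: "0 < e"
    \<comment> \<open>The infima need not be attained, so each gauge gets a slack of
      \<open>e / 2\<close>.\<close>
    define s t where "s = gauge_of U x + e / 2" and "t = gauge_of U y + e / 2"
    have pos: "0 < s" "0 < t"
      using e gauge_of_nonneg[of x] gauge_of_nonneg[of y] by (auto simp: s_def t_def)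
    obtain u v where uv: "u \<in> U" "v \<in> U" "x = s *\<^sub>R u" "y = t *\<^sub>R v"
      using gauge_of_less[of x s] gauge_of_less[of y t] e by (auto simp: s_def t_def)
    have "(s / (s + t)) *\<^sub>R u + (t / (s + t)) *\<^sub>R v \<in> U"
      using pos uv by (intro convexD[OF U]) (auto simp: add_divide_distrib[symmetric])
    moreover have "x + y = (s + t) *\<^sub>R ((s / (s + t)) *\<^sub>R u + (t / (s + t)) *\<^sub>R v)"
      using pos uv by (simp add: scaleR_add_right)
    ultimately have "gauge_of U (x + y) \<le> s + t"
      using pos by (intro gauge_of_le) auto
    then show "gauge_of U (x + y) \<le> gauge_of U x + gauge_of U y + e"
      by (simp add: s_def t_def)
  qed
next
  have "gauge_of U 0 \<le> e" if "0 < e" for e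
    using that zero_mem_absorbing by (intro gauge_of_le) auto
  then show "gauge_of U 0 = 0"
    using gauge_of_nonneg[of 0] by (meson antisym dense_ge)
next
  fix t :: real and x
  assume t: "0 < t"
  have "gauge_of U (t *\<^sub>R x) \<le> t * s" if s: "gauge_of U x < s" for s
  proof (rule gauge_of_le)
    obtain u where u: "u \<in> U" "x = s *\<^sub>R u"
      using gauge_of_less[OF s] by auto
    show "0 < t * s"
      using t s gauge_of_nonneg[of x] by simp
    show "t *\<^sub>R x \<in> (*\<^sub>R) (t * s) ` U"
      using u by auto
  qed
  then have "gauge_of U (t *\<^sub>R x) / t \<le> s" if "gauge_of U x < s" for s
    using t that by (simp add: field_simps)
  then have "gauge_of U (t *\<^sub>R x) / t \<le> gauge_of U x"
    by (rule dense_ge)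
  then show "gauge_of U (t *\<^sub>R x) \<le> t * gauge_of U x"
    using t by (simp add: field_simps)
qed

end

section \<open>Locally convex topologies\<close>

lemma locally_convex_topspace: "locally_convex_topology T \<Longrightarrow> topspace T = UNIV"
  by (simp add: locally_convex_topology_def)

text \<open>With \<open>S = T\<close> this covers translations and dilations, with \<open>S\<close>
  the real line the rays used for absorption.\<close>

lemma continuous_map_affine_curve:
  assumes T: "locally_convex_topology T"
    and f: "continuous_map S euclideanreal f" and g: "continuous_map S T g"
  shows "continuous_map S T (\<lambda>x. a + f x *\<^sub>R g x)"
proof -
  have top: "topspace T = UNIV"
    and add: "continuous_map (prod_topology T T) T (\<lambda>(x, y). x + y)"
    and scale: "continuous_map (prod_topology euclideanreal T) T (\<lambda>(a, x). a *\<^sub>R x)"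
    using T by (auto simp: locally_convex_topology_def)
  have "continuous_map S T (\<lambda>x. f x *\<^sub>R g x)"
    using continuous_map_compose[OF continuous_map_pairedI[OF f g] scale] by (simp add: o_def)
  moreover have "continuous_map S T (\<lambda>_. a)"
    by (simp add: top)
  ultimately have "continuous_map S (prod_topology T T) (\<lambda>x. (a, f x *\<^sub>R g x))"
    by (intro continuous_map_pairedI)
  from continuous_map_compose[OF this add] show ?thesis
    by (simp add: o_def)
qed

lemma openin_affine_preimage:
  assumes T: "locally_convex_topology T" and W: "openin T W"
  shows "openin T {x. a + c *\<^sub>R x \<in> W}"
  using openin_continuous_map_preimage[OF continuous_map_affine_curve[OF T, of T "\<lambda>_. c" "\<lambda>x. x" a] W]
  by (simp add: locally_convex_topspace[OF T])

lemma open_neighbourhood_absorbing: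
  assumes T: "locally_convex_topology T" and W: "openin T W" "0 \<in> W"
  shows "\<exists>t>0. x \<in> (*\<^sub>R) t ` W"
proof -
  have "openin euclideanreal {s. 0 + s *\<^sub>R x \<in> W}"
    using openin_continuous_map_preimage[OF continuous_map_affine_curve[OF T, of euclideanreal "\<lambda>s. s" "\<lambda>_. x" 0] W(1)]
    by (simp add: locally_convex_topspace[OF T])
  then have "open {s. s *\<^sub>R x \<in> W}"
    by simp
  moreover have "0 \<in> {s. s *\<^sub>R x \<in> W}"
    using W by simp
  ultimately obtain e where e: "0 < e" "ball 0 e \<subseteq> {s. s *\<^sub>R x \<in> W}"
    using open_contains_ball by blast
  then have "e / 2 \<in> {s. s *\<^sub>R x \<in> W}"
    by (intro subsetD[OF e(2)]) auto
  then have "inverse (e / 2) *\<^sub>R ((e / 2) *\<^sub>R x) \<in> (*\<^sub>R) (inverse (e / 2)) ` W"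
    by blast
  then show ?thesis
    using e by (intro exI[of _ "inverse (e / 2)"]) auto
qed

text \<open>A bound from above suffices: for \<open>x\<close> near \<open>x0\<close>, both
  \<open>c (x - x0)\<close> and \<open>c (x0 - x)\<close> lie in \<open>W\<close>, which controls
  \<open>l x - l x0\<close> on both sides.\<close>

lemma linear_bounded_above_imp_continuous:
  assumes T: "locally_convex_topology T" and l: "linear l"
    and W: "openin T W" "0 \<in> W" and le: "\<And>x. x \<in> W \<Longrightarrow> l x \<le> k"
  shows "continuous_map T euclideanreal l"
proof -
  have k: "0 \<le> k"
    using le[OF W(2)] l by (simp add: linear_0)
  have "openin T {x. l x \<in> S}" if S: "open S" for S
  proof (subst openin_subopen, safe)
    fix x0
    assume "l x0 \<in> S"
    then obtain e where e: "0 < e" "ball (l x0) e \<subseteq> S"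
      using S open_contains_ball by blast
    \<comment> \<open>The numerator \<open>k + 1\<close> keeps \<open>c\<close> positive when
      \<open>k = 0\<close> and makes \<open>k / c < e\<close> strict.\<close>
    define c where "c = (k + 1) / e"
    have c: "0 < c" "k / c < e"
      using e k by (auto simp: c_def field_simps)
    let ?V = "{x. - c *\<^sub>R x0 + c *\<^sub>R x \<in> W} \<inter> {x. c *\<^sub>R x0 + (- c) *\<^sub>R x \<in> W}"
    have "openin T ?V"
      by (intro openin_Int openin_affine_preimage T W)
    moreover have "x0 \<in> ?V"
      using W by simp
    moreover have "l x \<in> S" if "x \<in> ?V" for x
    proof -
      have "c * (l x - l x0) \<le> k" "c * (l x0 - l x) \<le> k"
        using that le[of "- c *\<^sub>R x0 + c *\<^sub>R x"] le[of "c *\<^sub>R x0 + (- c) *\<^sub>R x"] l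
        by (auto simp: linear_add linear_scale linear_neg linear_diff algebra_simps)
      then have "\<bar>l x - l x0\<bar> \<le> k / c"
        using c by (auto simp: field_simps abs_le_iff)
      with c e show ?thesis
        by (auto simp: dist_real_def subset_iff)
    qed
    ultimately show "\<exists>V. openin T V \<and> x0 \<in> V \<and> V \<subseteq> {x. l x \<in> S}"
      by blast
  qed
  then show ?thesis
    by (simp add: continuous_map_def locally_convex_topspace[OF T])
qed

text \<open>The convex neighbourhood \<open>U\<close> need not be open: \<open>U\<close> will supply
  the gauge, and the open set inside it absorption and continuity.\<close>

lemma locally_convex_neighbourhood:
  assumes T: "locally_convex_topology T" and W: "openin T W" "0 \<in> W"
  obtains O' U where "openin T O'" "convex U" "0 \<in> O'" "O' \<subseteq> U" "U \<subseteq> W"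
  using T W unfolding locally_convex_topology_def neighbourhood_base_of by metis

section \<open>Convex lower semicontinuous functions\<close>

text \<open>The epigraph of a supremum is the intersection of the epigraphs; an infinite
  \<open>k i\<close> contributes the empty set or the whole space.\<close>

lemma convex_function_SUP_affine:
  fixes l :: "'i \<Rightarrow> 'a::real_vector \<Rightarrow> real" and k :: "'i \<Rightarrow> ereal"
  assumes l: "\<And>i. linear (l i)"
  shows "convex_function (\<lambda>x. SUP i. ereal (l i x) + - k i)"
proof -
  have "convex {(x, r). ereal (l i x) + - k i \<le> ereal r}" for i
  proof (cases "k i")
    case (real a)
    show ?thesis
    proof (rule convexI, clarsimp simp: real)
      fix x y r s u v assume *: "l i x - a \<le> r" "l i y - a \<le> s" "0 \<le> u" "0 \<le> v" "u + v = (1::real)"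
      then have "u * (l i x - a) + v * (l i y - a) \<le> u * r + v * s"
        by (intro add_mono mult_left_mono)
      moreover have "u * a + v * a = a"
        using * by (metis distrib_right mult_1)
      ultimately show "l i (u *\<^sub>R x + v *\<^sub>R y) - a \<le> u * r + v * s"
        using l[of i] by (simp add: linear_add linear_scale algebra_simps)
    qed
  qed (auto simp: case_prod_unfold)
  then have "convex (\<Inter>i. {(x, r). ereal (l i x) + - k i \<le> ereal r})"
    by (intro convex_INT) auto
  moreover have "(\<Inter>i. {(x, r). ereal (l i x) + - k i \<le> ereal r}) =
      {(x, r). (SUP i. ereal (l i x) + - k i) \<le> ereal r}"
    by (auto simp: SUP_le_iff)
  ultimately show ?thesis
    by (simp add: convex_function_def)
qed

lemma lower_semicontinuous_SUP_affine:
  fixes l :: "'i \<Rightarrow> 'a::real_vector \<Rightarrow> real" and k :: "'i \<Rightarrow> ereal"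
  assumes l: "\<And>i. continuous_map T euclideanreal (l i)"
  shows "lower_semicontinuous T (\<lambda>x. SUP i. ereal (l i x) + - k i)"
  unfolding lower_semicontinuous_def
proof
  fix a
  have "closedin T {x \<in> topspace T. ereal (l i x) + - k i \<le> a}" for i
  proof -
    have "closed {r. ereal r + - k i \<le> a}"
      by (cases "k i"; cases a) (auto simp: diff_le_eq simp flip: atMost_def)
    then show ?thesis
      using closedin_continuous_map_preimage[OF l, of "{r. ereal r + - k i \<le> a}" i] by simp
  qed
  then have "closedin T (\<Inter>i. {x \<in> topspace T. ereal (l i x) + - k i \<le> a})"
    by (intro closedin_INT) auto
  moreover have "(\<Inter>i. {x \<in> topspace T. ereal (l i x) + - k i \<le> a}) =
      {x \<in> topspace T. (SUP i. ereal (l i x) + - k i) \<le> a}"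
    by (auto simp: SUP_le_iff)
  ultimately show "closedin T {x \<in> topspace T. (SUP i. ereal (l i x) + - k i) \<le> a}"
    by simp
qed

section \<open>Affine minorants of convex lower semicontinuous functions\<close>

lemma convex_functionD:
  assumes F: "convex_function F" and "F x \<le> ereal r" "F y \<le> ereal s"
    and uv: "0 \<le> u" "0 \<le> v" "u + v = 1"
  shows "F (u *\<^sub>R x + v *\<^sub>R y) \<le> ereal (u * r + v * s)"
  using convexD[OF F[unfolded convex_function_def] _ _ uv, of "(x, r)" "(y, s)"] assms(2,3) by simp

text \<open>Values of \<open>F\<close> far from \<open>z0\<close> are controlled, by convexity along segments issuing from \<open>z0\<close>,
  by the values on the neighbourhood \<open>z0 + U\<close>.\<close>

lemma convex_function_gauge_lower_bound:
  fixes F :: "'a::real_vector \<Rightarrow> ereal"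
  assumes F: "convex_function F" and z0: "F z0 = ereal a"
    and U: "convex U" and absorbing: "\<And>x. \<exists>t>0. x \<in> (*\<^sub>R) t ` U"
    and near: "\<And>u. u \<in> U \<Longrightarrow> ereal (a - 1) < F (z0 + u)"
    and z: "F z \<le> ereal r"
  shows "a - 2 - gauge_of U (z - z0) \<le> r"
proof -
  let ?q = "gauge_of U"
  \<comment> \<open>Adding 1 makes \<open>t\<close> exceed the gauge, so \<open>z - z0\<close> lies
    in the dilate of \<open>U\<close> by \<open>t\<close>, and makes \<open>1 / t\<close> a convex
    weight.\<close>
  define t where "t = ?q (z - z0) + 1"
  have t: "1 \<le> t"
    using gauge_of_nonneg[OF U absorbing, of "z - z0"] by (simp add: t_def)
  obtain u where u: "u \<in> U" "z - z0 = t *\<^sub>R u"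
    using gauge_of_less[OF U absorbing, of "z - z0" t] by (auto simp: t_def)
  have "z = z0 + t *\<^sub>R u"
    using u by (simp add: algebra_simps)
  then have "(1 - 1 / t) *\<^sub>R z0 + (1 / t) *\<^sub>R z = z0 + u"
    using t by (simp add: algebra_simps)
  then have "F (z0 + u) \<le> ereal ((1 - 1 / t) * a + (1 / t) * r)"
    using convex_functionD[OF F, of z0 a z r "1 - 1 / t" "1 / t"] z0 z t by simp
  with near[OF u(1)] have "ereal (a - 1) < ereal ((1 - 1 / t) * a + (1 / t) * r)"
    by (rule less_le_trans)
  then have "a - 1 < (1 - 1 / t) * a + (1 / t) * r"
    by simp
  then have "t * (a - 1) < t * ((1 - 1 / t) * a + (1 / t) * r)"
    using t by (intro mult_strict_left_mono) auto
  then have "a - t < r"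
    using t by (simp add: algebra_simps)
  then show ?thesis
    by (simp add: t_def)
qed

lemma lower_semicontinuous_openin:
  assumes "locally_convex_topology T" and F: "lower_semicontinuous T F"
  shows "openin T {x. a < F x}"
proof -
  have "openin T (topspace T - {x \<in> topspace T. F x \<le> a})"
    using F by (auto simp: lower_semicontinuous_def)
  moreover have "topspace T - {x \<in> topspace T. F x \<le> a} = {x. a < F x}"
    using locally_convex_topspace[OF assms(1)] by auto
  ultimately show ?thesis
    by simp
qed

theorem continuous_affine_minorant:
  fixes F :: "'a::real_vector \<Rightarrow> ereal"
  assumes T: "locally_convex_topology T"
    and F: "convex_function F" and lsc: "lower_semicontinuous T F" and proper: "\<And>x. F x \<noteq> -\<infinity>"
    and r: "ereal r < F x0"
  obtains l where "l \<in> continuous_linear_forms T" "\<And>z. ereal (r + l (z - x0)) \<le> F z"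
proof (cases "\<exists>z. F z \<noteq> \<infinity>")
  case False
  have "(\<lambda>_. 0) \<in> continuous_linear_forms T"
    by (simp add: continuous_linear_forms_def linear_iff)
  then show ?thesis
    using that False by force
next
  case True
  then obtain z0 a where z0: "F z0 = ereal a"
    using proper by (metis ereal_cases)
  \<comment> \<open>One neighbourhood of 0 serves two points: \<open>F > r\<close> near
    \<open>x0\<close>, and \<open>F > a - 1\<close> near \<open>z0\<close> for the gauge
    bound.\<close>
  let ?W = "{u. x0 + 1 *\<^sub>R u \<in> {x. ereal r < F x}} \<inter> {u. z0 + 1 *\<^sub>R u \<in> {x. ereal (a - 1) < F x}}"
  have "openin T ?W"
    by (intro openin_Int openin_affine_preimage lower_semicontinuous_openin T lsc)
  moreover have "0 \<in> ?W"
    using r z0 by simp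
  ultimately obtain V U where V: "openin T V" "0 \<in> V" "V \<subseteq> U" and U: "convex U" and "U \<subseteq> ?W"
    by (rule locally_convex_neighbourhood[OF T])
  then have nearx: "ereal r < F (x0 + u)" and nearz: "ereal (a - 1) < F (z0 + u)" if "u \<in> U" for u
    using that by auto
  have absorbing: "\<exists>t>0. x \<in> (*\<^sub>R) t ` U" for x
    using open_neighbourhood_absorbing[OF T V(1,2), of x] V(3) by blast
  define q where "q = gauge_of U"
  note q_nonneg = gauge_of_nonneg[OF U absorbing, folded q_def]
  note q_less = gauge_of_less[OF U absorbing, folded q_def]
  note q_le_1 = gauge_of_le_1[OF U absorbing, folded q_def]
  have q: "sublinear q"
    unfolding q_def by (rule sublinear_gauge_of[OF U absorbing])
  \<comment> \<open>Recentring the gauge bound from \<open>z0\<close> to \<open>x0\<close> by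
    subadditivity gives \<open>F (x0 + u) >= A - q u\<close>.\<close>
  define A where "A = a - 2 - q (x0 - z0)"
  \<comment> \<open>As \<open>k - 1\<close> is nonnegative and at least \<open>r - A\<close>, the
    bound \<open>A - q u\<close> is at least \<open>r - k * q u\<close> once
    \<open>q u >= 1\<close>.\<close>
  define k where "k = max 0 (r - A) + 1"
  \<comment> \<open>If \<open>q u < 1\<close>, then \<open>u\<close> lies in \<open>U\<close> and
    \<open>F (x0 + u) > r\<close>, so the left side is negative; otherwise the choice of
    \<open>k\<close> applies.\<close>
  have bound: "r - s \<le> k * q u" if s: "F (x0 + u) \<le> ereal s" for u s
  proof (cases "q u < 1")
    case True
    then have "ereal r < F (x0 + u)"
      using q_less[OF True] by (intro nearx) auto
    then have "r < s"
      using s by (meson less_le_trans ereal_less_eq(3) less_ereal.simps(1))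
    moreover have "0 \<le> k * q u"
      using q_nonneg by (simp add: k_def)
    ultimately show ?thesis
      by simp
  next
    case False
    have "a - 2 - q (x0 + u - z0) \<le> s"
      unfolding q_def
      by (rule convex_function_gauge_lower_bound[OF F z0 U absorbing nearz s])
    moreover have "q (x0 + u - z0) \<le> q (x0 - z0) + q u"
      using sublinear_add[OF q, of "x0 - z0" u] by (simp add: algebra_simps)
    ultimately have "A - q u \<le> s"
      by (simp add: A_def)
    moreover have "(k - 1) * 1 \<le> (k - 1) * q u"
      using False by (intro mult_left_mono) (auto simp: k_def)
    moreover have "r - A \<le> k - 1"
      by (simp add: k_def)
    ultimately show ?thesis
      by (simp add: algebra_simps)
  qed
  \<comment> \<open>This is the hypograph of the concave function \<open>r - F (x0 + u)\<close>,
    nonempty because \<open>F z0\<close> is finite.\<close>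
  let ?E = "{(u, s). F (x0 + u) \<le> ereal (r - s)}"
  have "convex ?E"
  proof (rule convexI, clarsimp)
    fix u s u' s' c d
    assume *: "F (x0 + u) \<le> ereal (r - s)" "F (x0 + u') \<le> ereal (r - s')"
      "0 \<le> c" "0 \<le> d" "c + d = (1::real)"
    have "c *\<^sub>R (x0 + u) + d *\<^sub>R (x0 + u') = (c + d) *\<^sub>R x0 + (c *\<^sub>R u + d *\<^sub>R u')"
      by (simp add: algebra_simps)
    moreover have "c * (r - s) + d * (r - s') = (c + d) * r - (c * s + d * s')"
      by (simp add: algebra_simps)
    ultimately show "F (x0 + (c *\<^sub>R u + d *\<^sub>R u')) \<le> ereal (r - (c * s + d * s'))"
      using convex_functionD[OF F *] * by simp
  qed
  moreover have "(z0 - x0, r - a) \<in> ?E"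
    using z0 by simp
  moreover have "sublinear (\<lambda>u. k * q u)"
  proof -
    have "0 \<le> k"
      by (simp add: k_def)
    then show ?thesis
      using q by (auto simp: sublinear_def mult_left_mono simp flip: distrib_left)
  qed
  moreover have "s \<le> k * q u" if "(u, s) \<in> ?E" for u s
    using bound[of u "r - s"] that by simp
  ultimately obtain l where l: "linear l" "l \<le> (\<lambda>u. k * q u)" "\<And>u s. (u, s) \<in> ?E \<Longrightarrow> s \<le> l u"
    using Hahn_Banach_sandwich[of "\<lambda>u. k * q u" ?E] by blast
  have "l u \<le> k" if "u \<in> V" for u
  proof -
    have "l u \<le> k * q u"
      using l(2) by (simp add: le_fun_def)
    also have "\<dots> \<le> k * 1"
      using that V(3) q_le_1 by (intro mult_left_mono) (auto simp: k_def)
    finally show ?thesis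
      by simp
  qed
  then have "continuous_map T euclideanreal l"
    using linear_bounded_above_imp_continuous[OF T l(1) V(1,2)] by blast
  \<comment> \<open>The sandwich gives \<open>r - F <= l\<close> after translation, so the minorant
    of \<open>F\<close> has slope \<open>- l\<close>.\<close>
  then have "(\<lambda>x. - l x) \<in> continuous_linear_forms T"
    using l(1) by (simp add: continuous_linear_forms_def linear_compose_neg continuous_map_minus)
  moreover have "ereal (r + - l (z - x0)) \<le> F z" for z
  proof (cases "F z")
    case (real s)
    then have "r - s \<le> l (z - x0)"
      by (intro l(3)) simp
    with real show ?thesis
      by simp
  qed (use proper in auto)
  ultimately show ?thesis
    using that by blast
qed

section \<open>Fenchel-Moreau duality and its transfer to the Caprac coupling\<close>

theorem fenchel_moreau:
  fixes F :: "'x::real_vector \<Rightarrow> ereal"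
  assumes pair: "paired_spaces TX TY b"
    and F: "convex_function F" "lower_semicontinuous TX F" and proper: "\<And>x. F x \<noteq> -\<infinity>"
  shows "F = reverse_conjugate b (coupling_conjugate b F)"
proof (rule ext, rule antisym)
  have T: "locally_convex_topology TX" and bil: "bilinear b"
    and forms: "continuous_linear_forms TX = range (\<lambda>y x. b x y)"
    using pair by (auto simp: paired_spaces_def)
  fix x0
  show "F x0 \<le> reverse_conjugate b (coupling_conjugate b F) x0"
  proof (rule dense_le)
    fix c assume "c < F x0"
    \<comment> \<open>Affine minorants are real-valued, while \<open>F x0\<close> may be infinite;
      hence a real level strictly between.\<close>
    then obtain r where r: "c < ereal r" "ereal r < F x0"
      using ereal_dense2 by blast
    obtain l where "l \<in> continuous_linear_forms TX" and l: "\<And>z. ereal (r + l (z - x0)) \<le> F z"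
      using continuous_affine_minorant[OF T F proper r(2)] by metis
    then obtain y where "l = (\<lambda>x. b x y)"
      using forms by auto
    with l have y: "ereal (r + (b z y - b x0 y)) \<le> F z" for z
      using bilinear_lsub[OF bil] by simp
    \<comment> \<open>The minorant with slope \<open>y\<close> and value \<open>r\<close> at
      \<open>x0\<close> becomes a bound on the conjugate at \<open>y\<close>, which returns
      \<open>r\<close> as a lower bound of the biconjugate at \<open>x0\<close>.\<close>
    have "ereal (b z y) + - F z \<le> ereal (b x0 y - r)" for z
      using y[of z] by (cases "F z") auto
    then have "coupling_conjugate b F y \<le> ereal (b x0 y - r)"
      by (auto simp: coupling_conjugate_def SUP_le_iff)
    then have "ereal r \<le> ereal (b x0 y) + - coupling_conjugate b F y"
      by (cases "coupling_conjugate b F y") auto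
    also have "\<dots> \<le> reverse_conjugate b (coupling_conjugate b F) x0"
      unfolding reverse_conjugate_def by (rule SUP_upper) simp
    finally show "c \<le> reverse_conjugate b (coupling_conjugate b F) x0"
      using r(1) by simp
  qed
  show "reverse_conjugate b (coupling_conjugate b F) x0 \<le> F x0"
    unfolding reverse_conjugate_def
  proof (rule SUP_least)
    fix y
    \<comment> \<open>This is the Fenchel-Young inequality.\<close>
    have "ereal (b x0 y) + - F x0 \<le> coupling_conjugate b F y"
      unfolding coupling_conjugate_def by (rule SUP_upper) simp
    then show "ereal (b x0 y) + - coupling_conjugate b F y \<le> F x0"
      by (cases "coupling_conjugate b F y"; cases "F x0") auto
  qed
qed

lemma reverse_conjugate_convex_lsc:
  assumes pair: "paired_spaces TX TY b"
  shows "convex_function (reverse_conjugate b g)" "lower_semicontinuous TX (reverse_conjugate b g)"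
proof -
  have "(\<lambda>x. b x y) \<in> continuous_linear_forms TX" for y
    using pair by (auto simp: paired_spaces_def)
  then have lin: "linear (\<lambda>x. b x y)" and cont: "continuous_map TX euclideanreal (\<lambda>x. b x y)" for y
    by (auto simp: continuous_linear_forms_def)
  show "convex_function (reverse_conjugate b g)" "lower_semicontinuous TX (reverse_conjugate b g)"
    unfolding reverse_conjugate_def[abs_def]
    using convex_function_SUP_affine[of "\<lambda>y x. b x y", OF lin]
      lower_semicontinuous_SUP_affine[of TX "\<lambda>y x. b x y", OF cont] by simp_all
qed

text \<open>The supremum runs over \<open>y\<close> alone, so the normalized point is just a fixed
  argument of the ordinary conjugate.\<close>

lemma reverse_conjugate_caprac:
  "reverse_conjugate (caprac b N) g = reverse_conjugate b g \<circ> normalization N"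
  by (auto simp: reverse_conjugate_def caprac_def)

theorem corollary6:
  fixes TX :: "'x::real_vector topology"
    and TY :: "'y::real_vector topology"
    and b :: "'x \<Rightarrow> 'y \<Rightarrow> real"
    and N :: "'x \<Rightarrow> real"
  assumes "paired_spaces TX TY b"
    and "norm_on_space N"
  shows "(\<forall>f :: 'x \<Rightarrow> ereal.
            convex_function (coupling_conjugate (caprac b N) f) \<and>
            lower_semicontinuous TY (coupling_conjugate (caprac b N) f)) \<and>
         (\<forall>f :: 'x \<Rightarrow> ereal.
            coupling_convex (caprac b N) f \<longleftrightarrow>
            (\<exists>F :: 'x \<Rightarrow> ereal.
               convex_function F \<and> lower_semicontinuous TX F \<and>
               ((\<exists>x. F x = -\<infinity>) \<longrightarrow> (\<forall>x. F x = -\<infinity>)) \<and>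
               f = F \<circ> normalization N))"
proof (intro conjI allI iffI)
  fix f :: "'x \<Rightarrow> ereal"
  have "(\<lambda>y. b x y) \<in> continuous_linear_forms TY" for x
    using assms(1) by (auto simp: paired_spaces_def)
  then have lin: "linear (caprac b N x)" and cont: "continuous_map TY euclideanreal (caprac b N x)" for x
    by (auto simp: continuous_linear_forms_def caprac_def[abs_def])
  show "convex_function (coupling_conjugate (caprac b N) f)"
    "lower_semicontinuous TY (coupling_conjugate (caprac b N) f)"
    unfolding coupling_conjugate_def[abs_def]
    using convex_function_SUP_affine[of "caprac b N", OF lin]
      lower_semicontinuous_SUP_affine[of TY "caprac b N", OF cont] by simp_all
next
  fix f :: "'x \<Rightarrow> ereal"
  assume "coupling_convex (caprac b N) f"
  then obtain g where "f = reverse_conjugate b g \<circ> normalization N"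
    by (auto simp: coupling_convex_def reverse_conjugate_caprac)
  \<comment> \<open>The candidate \<open>F\<close> is itself convex for the coupling
    \<open>b\<close>, so it is identically minus infinity as soon as it takes that value.\<close>
  moreover have "coupling_convex b (reverse_conjugate b g)"
    by (auto simp: coupling_convex_def)
  then have "(\<exists>x. reverse_conjugate b g x = -\<infinity>) \<longrightarrow> (\<forall>x. reverse_conjugate b g x = -\<infinity>)"
    by (metis coupling_convex_minus_infinity)
  ultimately show "\<exists>F. convex_function F \<and> lower_semicontinuous TX F \<and>
      ((\<exists>x. F x = -\<infinity>) \<longrightarrow> (\<forall>x. F x = -\<infinity>)) \<and> f = F \<circ> normalization N"
    using reverse_conjugate_convex_lsc[OF assms(1)] by blast
next
  fix f :: "'x \<Rightarrow> ereal"
  assume "\<exists>F. convex_function F \<and> lower_semicontinuous TX F \<and>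
      ((\<exists>x. F x = -\<infinity>) \<longrightarrow> (\<forall>x. F x = -\<infinity>)) \<and> f = F \<circ> normalization N"
  then obtain F where F: "convex_function F" "lower_semicontinuous TX F"
    and closed: "(\<exists>x. F x = -\<infinity>) \<longrightarrow> (\<forall>x. F x = -\<infinity>)" and f: "f = F \<circ> normalization N"
    by blast
  have "\<exists>g. F = reverse_conjugate b g"
  \<comment> \<open>If \<open>F\<close> takes the value minus infinity it is constant, and is the
    conjugate of the constant plus infinity; otherwise its biconjugate represents it.\<close>
  proof (cases "\<exists>x. F x = -\<infinity>")
    case True
    with closed have "F = reverse_conjugate b (\<lambda>_. \<infinity>)"
      by (auto simp: reverse_conjugate_def)
    then show ?thesis
      by (rule exI[of _ "\<lambda>_. \<infinity>"])
  next
    case False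
    then show ?thesis
      using fenchel_moreau[OF assms(1) F] by blast
  qed
  then show "coupling_convex (caprac b N) f"
    unfolding coupling_convex_def f by (auto simp: reverse_conjugate_caprac)
qed

end
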